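(* For any fixed $k\in\mathbb{N}=\{1,2,\dots\}$ and $\ell>-1/2$, the function $\eta\mapsto\rho_{\ell,\eta,k}$ is increasing on $\mathbb{R}$, that is, $$\frac{d\rho_{\ell,\eta,k}}{d\eta}>0\qquad\text{for all }\eta\in\mathbb{R}.$$
   Context: For real $\eta$ and $\ell>-1/2$, the regular Coulomb wave function is, for $x>0$, $$F_{\ell,\eta}(x)=C_{\ell,\eta}\,x^{\ell+1}e^{-ix}\,{}_1F_1(\ell+1-i\eta,\,2\ell+2;\,2ix),\qquad C_{\ell,\eta}=\frac{2^{\ell}e^{-\pi\eta/2}|\Gamma(\ell+1+i\eta)|}{\Gamma(2\ell+2)},$$ where ${}_1F_1(a,b;z)=\sum_{k\ge0}\frac{(a)_k}{(b)_k}\frac{z^k}{k!}$ and $(a)_k=\Gamma(a+k)/\Gamma(a)$. It is real-valued for $x>0$ and solves $y''+\left(1-\frac{2\eta}{x}-\frac{\ell(\ell+1)}{x^2}\right)y=0$. The numbers $\rho_{\ell,\eta,1}<\rho_{\ell,\eta,2}<\cdots$ denote all the (infinitely many) positive zeros of $F_{\ell,\eta}$ in increasing order. *)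

theory Defs
  imports "HOL-Analysis.Analysis"
begin

text \<open>
  Kummer's function. The library's \<^const>\<open>pochhammer\<close> is the product
  \<open>a (a+1) \<dots> (a+k-1)\<close>, which agrees with \<open>\<Gamma>(a+k) / \<Gamma>(a)\<close> whenever \<open>a\<close> is not a
  non-positive integer (\<open>pochhammer_Gamma\<close>); both parameters used below have positive
  real part.
\<close>

definition hyp1F1 :: "complex \<Rightarrow> complex \<Rightarrow> complex \<Rightarrow> complex" where
  "hyp1F1 a b z = (\<Sum>k. pochhammer a k / pochhammer b k * z ^ k / fact k)"

definition coulomb_C :: "real \<Rightarrow> real \<Rightarrow> real" where
  "coulomb_C l \<eta> =
     2 powr l * exp (- pi * \<eta> / 2) * cmod (Gamma (of_real l + 1 + \<i> * of_real \<eta>))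
       / Gamma (2 * l + 2)"

text \<open>
  Meaningful only for \<open>x > 0\<close>. The value is kept complex, exactly as the formula gives it;
  that it is real is a theorem, not part of the definition.
\<close>

definition coulomb_F :: "real \<Rightarrow> real \<Rightarrow> real \<Rightarrow> complex" where
  "coulomb_F l \<eta> x =
     of_real (coulomb_C l \<eta>) * of_real (x powr (l + 1)) * exp (- \<i> * of_real x)
       * hyp1F1 (of_real l + 1 - \<i> * of_real \<eta>) (2 * of_real l + 2) (2 * \<i> * of_real x)"

definition coulomb_zeros :: "real \<Rightarrow> real \<Rightarrow> real set" where
  "coulomb_zeros l \<eta> = {x. x > 0 \<and> coulomb_F l \<eta> x = 0}"

text \<open>
  The \<open>k\<close>-th positive zero, counted from \<open>k = 1\<close>: the zero \<open>x\<close> for which exactly \<open>k\<close> zeros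
  lie in \<open>(0, x]\<close>. There is at most one such \<open>x\<close> for \<open>k \<ge> 1\<close>, since a nonzero \<^const>\<open>card\<close>
  forces the set to be finite.
\<close>

definition coulomb_rho :: "real \<Rightarrow> real \<Rightarrow> nat \<Rightarrow> real" where
  "coulomb_rho l \<eta> k =
     (THE x. x \<in> coulomb_zeros l \<eta> \<and> card {y \<in> coulomb_zeros l \<eta>. y \<le> x} = k)"

end

theory Submission imports Defs begin

text \<open>
  Write \<open>F(x) = C x\<^sup>l\<^sup>+\<^sup>1 g(x)\<close>. Kummer's transformation makes \<open>g = g\<^sub>\<eta>\<close> real on the real line, the
  constant \<open>C\<close> is positive, and so the positive zeros of \<open>F\<close> are those of \<open>g\<^sub>\<eta>\<close>. The function
  \<open>g\<^sub>\<eta>\<close> is entire in \<open>x\<close>, equals \<open>1\<close> at the origin and solves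
  \<open>x g'' + (2l + 2) g' + (x - 2\<eta>) g = 0\<close>.

  Everything rests on a comparison of two parameters \<open>s\<close> and \<open>t\<close>. The weighted Wronskian
  \<open>x\<^sup>2\<^sup>l\<^sup>+\<^sup>2 (g\<^sub>s g\<^sub>t' - g\<^sub>s' g\<^sub>t)\<close> vanishes at \<open>0\<close> and has the derivative
  \<open>2 (t - s) x\<^sup>2\<^sup>l\<^sup>+\<^sup>1 g\<^sub>s g\<^sub>t\<close>. Hence at a zero \<open>r\<close> of \<open>g\<^sub>s\<close>, with
  \<open>I(t)\<close> the integral of \<open>x\<^sup>2\<^sup>l\<^sup>+\<^sup>1 g\<^sub>s g\<^sub>t\<close> over \<open>[0, r]\<close>,
  \<open>- r\<^sup>2\<^sup>l\<^sup>+\<^sup>2 g\<^sub>s'(r) g\<^sub>t(r) = 2 (t - s) I(t)\<close>  (lemma \<open>coulomb_Wronskian_at_zero\<close>).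
  As \<open>t\<close> tends to \<open>s\<close>, \<open>I(t)\<close> tends to \<open>I(s)\<close>, the integral of a nonnegative function that is not
  identically zero, so \<open>I(s) > 0\<close>. This has two consequences.

  First, \<open>g\<^sub>s'(r) \<noteq> 0\<close>, for otherwise \<open>I(t) = 0\<close> for all \<open>t \<noteq> s\<close>: all zeros are simple. For
  a family of functions with simple zeros that depends continuously on a parameter, together with its
  \<open>x\<close>-derivative, the number of zeros in a fixed interval whose end points are not zeros is locally
  constant, and it follows that the \<open>k\<close>-th zero \<open>\<rho>(t)\<close> is a continuous function of the parameter. That there is a \<open>k\<close>-th zero at
  all is Sturm's comparison with \<open>y'' + y / 4 = 0\<close> for large \<open>x\<close>.

  Second, with \<open>r = \<rho>(s)\<close> the mean value theorem gives
  \<open>g\<^sub>t(r) = g\<^sub>t'(\<xi>) (r - \<rho>(t))\<close> for some \<open>\<xi>\<close> between \<open>r\<close> and \<open>\<rho>(t)\<close>, and therefore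
  \<open>(\<rho>(t) - \<rho>(s)) / (t - s) = 2 I(t) / (r\<^sup>2\<^sup>l\<^sup>+\<^sup>2 g\<^sub>s'(r) g\<^sub>t'(\<xi>))\<close>.
  The right-hand side tends to \<open>2 I(s) / (r\<^sup>2\<^sup>l\<^sup>+\<^sup>2 g\<^sub>s'(r)\<^sup>2) > 0\<close>. In this way differentiability
  of \<open>\<rho>\<close> is obtained from continuity of \<open>g\<close> and \<open>g'\<close> in both variables.
\<close>

section \<open>Zeros of functions depending on a parameter\<close>

lemma continuous_nonvanishing_same_sign:
  fixes g :: "real \<Rightarrow> real"
  assumes "continuous_on {a..b} g" "\<And>x. x \<in> {a..b} \<Longrightarrow> g x \<noteq> 0" "x \<in> {a..b}" "y \<in> {a..b}"
  shows "g x * g y > 0"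
proof (rule ccontr)
  assume "\<not> g x * g y > 0"
  then have "0 \<in> closed_segment (g x) (g y)"
    using assms by (auto simp: closed_segment_eq_real_ivl zero_less_mult_iff not_less)
  moreover have "connected (g ` {a..b})"
    using assms(1) by (intro connected_continuous_image) auto
  ultimately have "0 \<in> g ` {a..b}"
    using assms(3,4) by (meson closed_segment_subset convex_connected is_interval_connected_1
        is_interval_convex_1 imageI subsetD)
  then show False using assms(2) by auto
qed

text \<open>
  Infinitely many zeros would accumulate at some zero \<open>z\<close>, and the difference quotients at \<open>z\<close> along
  these zeros would force \<open>f' z = 0\<close>.
\<close>

lemma finite_simple_zeros:
  fixes f f' :: "real \<Rightarrow> real"
  assumes deriv: "\<And>x. (f has_real_derivative f' x) (at x)"
    and simple: "\<And>x. x \<in> {a..b} \<Longrightarrow> f x = 0 \<Longrightarrow> f' x \<noteq> 0"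
  shows "finite {x \<in> {a..b}. f x = 0}"
proof (rule ccontr)
  define S where "S = {x \<in> {a..b}. f x = 0}"
  assume "infinite {x \<in> {a..b}. f x = 0}"
  then have "infinite S" "S \<subseteq> {a..b}" by (auto simp: S_def)
  then obtain z where z: "z islimpt S"
    using Heine_Borel_imp_Bolzano_Weierstrass[OF compact_Icc] by blast
  have "continuous_on {a..b} f"
    by (meson DERIV_isCont continuous_at_imp_continuous_on deriv)
  then have "closed S"
    using continuous_closed_preimage_constant[of "{a..b}" f 0] by (simp add: S_def)
  with z have "z \<in> S" by (simp add: closed_limpt)
  then have fz: "f z = 0" "f' z \<noteq> 0" using simple by (auto simp: S_def)
  have "((\<lambda>x. (f x - f z) / (x - z)) \<longlongrightarrow> f' z) (at z)"
    using deriv[of z] by (simp add: has_field_derivative_iff)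
  then have "eventually (\<lambda>x. (f x - f z) / (x - z) \<noteq> 0) (at z)"
    by (rule tendsto_imp_eventually_ne) (use fz in simp)
  then have "eventually (\<lambda>x. x \<notin> S) (at z)"
    by eventually_elim (use fz in \<open>auto simp: S_def\<close>)
  with z show False by (simp add: islimpt_iff_eventually)
qed

text \<open>
  The tube lemma, applied to the open set on which \<open>f\<close> does not vanish.
\<close>

lemma eventually_nonzero_on_compact:
  fixes f :: "'a::topological_space \<Rightarrow> 'b::topological_space \<Rightarrow> real"
  assumes "continuous_on UNIV (\<lambda>(t, x). f t x)" "compact K" "\<And>x. x \<in> K \<Longrightarrow> f t0 x \<noteq> 0"
  shows "eventually (\<lambda>t. \<forall>x\<in>K. f t x \<noteq> 0) (nhds t0)"
proof -
  define W where "W = {p. (\<lambda>(t, x). f t x) p \<noteq> 0}"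
  have "open W"
    unfolding W_def using assms(1) by (intro open_Collect_neq continuous_on_const) auto
  moreover have "{t0} \<times> K \<subseteq> W" using assms(3) by (auto simp: W_def)
  ultimately obtain T where "t0 \<in> T" "open T" "T \<times> K \<subseteq> W"
    using Elementary_Topology.tube_lemma[OF assms(2)] by metis
  then show ?thesis
    unfolding eventually_nhds W_def by (intro exI[of _ T]) auto
qed

lemma ex1_zero_if_sign_change:
  fixes f f' :: "real \<Rightarrow> real"
  assumes deriv: "\<And>x. (f has_real_derivative f' x) (at x)"
    and "a < b" "\<And>x. x \<in> {a..b} \<Longrightarrow> f' x \<noteq> 0" "f a * f b < 0"
  shows "\<exists>!x. x \<in> {a..b} \<and> f x = 0"
proof -
  have cont: "continuous_on {a..b} f"
    by (meson DERIV_isCont continuous_at_imp_continuous_on deriv)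
  have "\<exists>x. x \<in> {a..b} \<and> f x = 0"
    using continuous_nonvanishing_same_sign[OF cont, of a b] assms by fastforce
  moreover have "x = y" if "x \<in> {a..b}" "f x = 0" "y \<in> {a..b}" "f y = 0" for x y
  proof -
    have False if xy: "x < y" "x \<in> {a..b}" "f x = 0" "y \<in> {a..b}" "f y = 0" for x y
    proof -
      obtain z where "x < z" "z < y" "f y - f x = (y - x) * f' z"
        using MVT2[OF xy(1), of f f'] deriv by blast
      then show False using xy assms(3)[of z] by auto
    qed
    from this[of x y] this[of y x] that show ?thesis by fastforce
  qed
  ultimately show ?thesis by blast
qed

text \<open>
  Around every zero of \<open>f t0\<close> take an interval of radius \<open>e\<close>, so small that these intervals are disjoint,
  lie in \<open>{a..b}\<close>, and \<open>f' t0\<close> vanishes on none of them. For \<open>t\<close> close to \<open>t0\<close>, \<open>f' t\<close> still has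
  no zero there and \<open>f t\<close> still changes sign across each interval, so \<open>f t\<close> has exactly one zero in each.
  The rest of \<open>{a..b}\<close> is compact and free of zeros of \<open>f t0\<close>, hence of zeros of \<open>f t\<close>. The condition
  at the end points keeps zeros from entering or leaving \<open>{a..b}\<close>.
\<close>

lemma card_zeros_locally_constant:
  fixes f f' :: "'a::t2_space \<Rightarrow> real \<Rightarrow> real"
  assumes cont: "continuous_on UNIV (\<lambda>(t, x). f t x)"
    and cont': "continuous_on UNIV (\<lambda>(t, x). f' t x)"
    and deriv: "\<And>t x. (f t has_real_derivative f' t x) (at x)"
    and simple: "\<And>x. x \<in> {a..b} \<Longrightarrow> f t0 x = 0 \<Longrightarrow> f' t0 x \<noteq> 0"
    and ends: "f t0 a \<noteq> 0" "f t0 b \<noteq> 0"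
  shows "eventually (\<lambda>t. card {x \<in> {a..b}. f t x = 0} = card {x \<in> {a..b}. f t0 x = 0}) (nhds t0)"
proof -
  define S where "S t = {x \<in> {a..b}. f t x = 0}" for t
  have fin: "finite (S t0)"
    unfolding S_def using deriv simple by (rule finite_simple_zeros)
  have cont_x': "continuous_on A (f' t)" for t A
    using continuous_on_compose2[OF cont' continuous_on_Pair[OF continuous_on_const[of A t] continuous_on_id]]
    by simp
  have cont_t: "((\<lambda>t. f t x) \<longlongrightarrow> f t0 x) (nhds t0)" for x
    using continuous_on_compose2[OF cont continuous_on_Pair[OF continuous_on_id continuous_on_const[of UNIV x]]]
      tendsto_at_iff_tendsto_nhds[of "\<lambda>t. f t x" t0]
    by (simp add: continuous_on_eq_continuous_at isCont_def)
  have small: "eventually (\<lambda>e. \<forall>x\<in>{z-e..z+e}. x \<in> {a..b} \<and> f' t0 x \<noteq> 0) (at_right 0)"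
    if "z \<in> S t0" for z
  proof -
    have "z \<noteq> a" "z \<noteq> b" using that ends by (auto simp: S_def)
    then have z: "z \<in> {a<..<b}" using that by (auto simp: S_def)
    have "open {x. f' t0 x \<noteq> 0}"
      by (intro open_Collect_neq cont_x' continuous_on_const)
    then have "open ({x. f' t0 x \<noteq> 0} \<inter> {a<..<b})" by (intro open_Int) auto
    moreover have "z \<in> {x. f' t0 x \<noteq> 0} \<inter> {a<..<b}"
      using z simple that by (auto simp: S_def)
    ultimately obtain d where d: "d > 0" "ball z d \<subseteq> {x. f' t0 x \<noteq> 0} \<inter> {a<..<b}"
      by (meson openE)
    have "eventually (\<lambda>e. e < d) (at_right 0)"
      using d(1) by (auto simp: eventually_at_right_less eventually_at_right)
    then show ?thesis
    proof eventually_elim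
      case (elim e)
      have "x \<in> ball z d" if "x \<in> {z-e..z+e}" for x
        using that elim by (auto simp: dist_real_def)
      then show ?case using d(2) by fastforce
    qed
  qed
  have sep: "eventually (\<lambda>e. \<forall>w\<in>S t0 - {z}. 2 * e < \<bar>w - z\<bar>) (at_right 0)" for z
  proof (intro eventually_ball_finite ballI)
    fix w assume "w \<in> S t0 - {z}"
    then have "\<bar>w - z\<bar> / 2 > 0" by simp
    then have "eventually (\<lambda>e. e < \<bar>w - z\<bar> / 2) (at_right 0)"
      unfolding eventually_at_right_field by blast
    then show "eventually (\<lambda>e. 2 * e < \<bar>w - z\<bar>) (at_right 0)"
      by eventually_elim simp
  qed (use fin in simp)
  have "eventually (\<lambda>e. e > 0 \<and> (\<forall>z\<in>S t0. \<forall>x\<in>{z-e..z+e}. x \<in> {a..b} \<and> f' t0 x \<noteq> 0)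
      \<and> (\<forall>z\<in>S t0. \<forall>w\<in>S t0 - {z}. 2 * e < \<bar>w - z\<bar>)) (at_right (0::real))"
    using small sep fin
    by (intro eventually_conj eventually_ball_finite eventually_at_right_less) auto
  then have "\<exists>e>0. (\<forall>z\<in>S t0. \<forall>x\<in>{z-e..z+e}. x \<in> {a..b} \<and> f' t0 x \<noteq> 0)
      \<and> (\<forall>z\<in>S t0. \<forall>w\<in>S t0 - {z}. 2 * e < \<bar>w - z\<bar>)"
    by (rule eventually_happens'[OF trivial_limit_at_right_real])
  then obtain e where e0: "e > 0"
      "\<forall>z\<in>S t0. \<forall>x\<in>{z-e..z+e}. x \<in> {a..b} \<and> f' t0 x \<noteq> 0"
      "\<forall>z\<in>S t0. \<forall>w\<in>S t0 - {z}. 2 * e < \<bar>w - z\<bar>"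
    by blast
  have e: "e > 0" "\<And>z x. z \<in> S t0 \<Longrightarrow> x \<in> {z-e..z+e} \<Longrightarrow> x \<in> {a..b}"
      "\<And>z x. z \<in> S t0 \<Longrightarrow> x \<in> {z-e..z+e} \<Longrightarrow> f' t0 x \<noteq> 0"
      "\<And>z w. z \<in> S t0 \<Longrightarrow> w \<in> S t0 \<Longrightarrow> w \<noteq> z \<Longrightarrow> 2 * e < \<bar>w - z\<bar>"
    using e0 by blast+
  have ev_away: "eventually (\<lambda>t. \<forall>x\<in>{a..b} - (\<Union>z\<in>S t0. ball z e). f t x \<noteq> 0) (nhds t0)"
  proof (rule eventually_nonzero_on_compact[OF cont])
    show "compact ({a..b} - (\<Union>z\<in>S t0. ball z e))"
      by (intro compact_diff open_UN ballI) auto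
    show "f t0 x \<noteq> 0" if "x \<in> {a..b} - (\<Union>z\<in>S t0. ball z e)" for x
      using that e(1) by (auto simp: S_def dist_real_def)
  qed
  \<comment> \<open>The mean value theorem on either side of \<open>z\<close>, where \<open>f' t0\<close> keeps its sign, shows that \<open>f t0\<close>
    changes sign between \<open>z - e\<close> and \<open>z + e\<close>; this is an open condition on \<open>t\<close>.\<close>
  have ev_near: "eventually (\<lambda>t. \<exists>!x. x \<in> {z-e..z+e} \<and> f t x = 0) (nhds t0)" if z: "z \<in> S t0" for z
  proof -
    obtain u where u: "z < u" "u < z + e" "f t0 (z + e) - f t0 z = e * f' t0 u"
      using MVT2[of z "z + e" "f t0" "f' t0"] deriv e(1) by auto
    obtain v where v: "z - e < v" "v < z" "f t0 z - f t0 (z - e) = e * f' t0 v"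
      using MVT2[of "z - e" z "f t0" "f' t0"] deriv e(1) by auto
    have "f' t0 u * f' t0 v > 0"
      by (rule continuous_nonvanishing_same_sign[OF cont_x'[of "{z-e..z+e}"] e(3)[OF z]]) (use u v e(1) in auto)
    then have "e * e * (f' t0 u * f' t0 v) > 0" using e(1) by simp
    moreover have "f t0 z = 0" using z by (simp add: S_def)
    ultimately have "f t0 (z - e) * f t0 (z + e) < 0" using u(3) v(3) 
      by (smt (verit) mult.assoc mult.commute mult_minus_left)
    moreover have "((\<lambda>t. f t (z - e) * f t (z + e)) \<longlongrightarrow> f t0 (z - e) * f t0 (z + e)) (nhds t0)"
      by (intro tendsto_mult cont_t)
    ultimately have "eventually (\<lambda>t. f t (z - e) * f t (z + e) < 0) (nhds t0)"
      by (simp add: order_tendstoD(2))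
    moreover have "eventually (\<lambda>t. \<forall>x\<in>{z-e..z+e}. f' t x \<noteq> 0) (nhds t0)"
      using cont' e(3)[OF z] by (intro eventually_nonzero_on_compact) auto
    ultimately show ?thesis
    proof eventually_elim
      case (elim t)
      then show ?case
        using e(1) by (intro ex1_zero_if_sign_change[of "f t" "f' t"] deriv) auto
    qed
  qed
  then have "eventually (\<lambda>t. \<forall>z\<in>S t0. \<exists>!x. x \<in> {z-e..z+e} \<and> f t x = 0) (nhds t0)"
    using fin by (intro eventually_ball_finite) auto
  with ev_away have "eventually (\<lambda>t. card (S t) = card (S t0)) (nhds t0)"
  proof eventually_elim
    case (elim t)
    then obtain h where h: "\<And>z. z \<in> S t0 \<Longrightarrow> h z \<in> {z-e..z+e} \<and> f t (h z) = 0"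
      by metis
    have "bij_betw h (S t0) (S t)"
    proof (intro bij_betw_imageI inj_onI equalityI subsetI)
      fix z w assume zw: "z \<in> S t0" "w \<in> S t0" "h z = h w"
      then have "\<bar>w - z\<bar> \<le> 2 * e"
        using h[of z] h[of w] by auto
      then show "z = w" using zw e(4)[of z w] by fastforce
    next
      fix x assume "x \<in> h ` S t0"
      then obtain z where "z \<in> S t0" "x = h z" by blast
      then show "x \<in> S t" using h[of z] e(2)[of z x] by (simp add: S_def)
    next
      fix x assume x: "x \<in> S t"
      then have "x \<in> {a..b}" "f t x = 0" by (simp_all add: S_def)
      then have "x \<in> (\<Union>z\<in>S t0. ball z e)" using elim(1) by blast
      then obtain z where z: "z \<in> S t0" "x \<in> ball z e" by blast
      have "x \<in> {z-e..z+e} \<and> f t x = 0"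
        using z(2) x by (auto simp: S_def dist_real_def)
      moreover have "\<exists>!y. y \<in> {z-e..z+e} \<and> f t y = 0" using elim(2) z(1) by blast
      ultimately have "x = h z" using h[OF z(1)] by blast
      then show "x \<in> h ` S t0" using z by blast
    qed
    then show ?case by (simp add: bij_betw_same_card)
  qed
  then show ?thesis by (simp add: S_def)
qed

lemma kth_element_unique:
  fixes Z :: "real set"
  assumes "\<And>X. finite {y \<in> Z. y \<le> X}" "x \<in> Z" "x' \<in> Z"
    "card {y \<in> Z. y \<le> x} = card {y \<in> Z. y \<le> x'}"
  shows "x = x'"
proof -
  have "\<not> x < x'" if "x \<in> Z" "x' \<in> Z" "card {y \<in> Z. y \<le> x} = card {y \<in> Z. y \<le> x'}" for x x'
  proof
    assume "x < x'"
    then have "{y \<in> Z. y \<le> x} \<subset> {y \<in> Z. y \<le> x'}" using that by force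
    then have "card {y \<in> Z. y \<le> x} < card {y \<in> Z. y \<le> x'}"
      using assms(1) by (intro psubset_card_mono)
    then show False using that by simp
  qed
  from this[of x x'] this[of x' x] show ?thesis using assms by fastforce
qed

text \<open>
  Starting from a bound \<open>X\<close>, the least element beyond \<open>X\<close> raises the count by exactly one; begin with
  \<open>X = 0\<close>, below which there are no elements.
\<close>

lemma kth_element_exists:
  fixes Z :: "real set"
  assumes fin: "\<And>X. finite {y \<in> Z. y \<le> X}" and unb: "\<And>X. \<exists>y\<in>Z. X < y"
    and "\<And>y. y \<in> Z \<Longrightarrow> 0 < y" "k \<ge> 1"
  shows "\<exists>x\<in>Z. card {y \<in> Z. y \<le> x} = k"
proof -
  have step: "\<exists>x\<in>Z. card {y \<in> Z. y \<le> x} = Suc (card {y \<in> Z. y \<le> X})" for X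
  proof -
    obtain u where u: "u \<in> Z" "X < u" using unb by blast
    define x where "x = Min {y \<in> Z. X < y \<and> y \<le> u}"
    have f: "finite {y \<in> Z. X < y \<and> y \<le> u}" by (rule finite_subset[OF _ fin[of u]]) auto
    have x: "x \<in> {y \<in> Z. X < y \<and> y \<le> u}" unfolding x_def using f u by (intro Min_in) auto
    have "x \<le> y" if "y \<in> Z" "X < y" for y
    proof (cases "y \<le> u")
      case True
      then show ?thesis unfolding x_def using that f by (intro Min_le) auto
    qed (use x in auto)
    then have "{y \<in> Z. y \<le> x} = insert x {y \<in> Z. y \<le> X}" using x by force
    then show ?thesis using x fin[of X] by (intro bexI[of _ x]) auto
  qed
  have "\<exists>x\<in>Z. card {y \<in> Z. y \<le> x} = Suc n" for n
  proof (induction n)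
    case 0
    have "{y \<in> Z. y \<le> 0} = {}" using assms(3) by force
    then show ?case using step[of 0] by (simp only: card.empty)
  next
    case (Suc n)
    then show ?case using step by metis
  qed
  from this[of "k - 1"] show ?thesis using assms(4) by simp
qed

text \<open>
  The description operator has the same form as in \<^const>\<open>coulomb_rho\<close>, so that the two agree by unfolding.
\<close>

definition kth_element :: "real set \<Rightarrow> nat \<Rightarrow> real" where
  "kth_element Z k = (THE x. x \<in> Z \<and> card {y \<in> Z. y \<le> x} = k)"

lemma kth_element:
  fixes Z :: "real set"
  assumes "\<And>X. finite {y \<in> Z. y \<le> X}" "\<And>X. \<exists>y\<in>Z. X < y" "\<And>y. y \<in> Z \<Longrightarrow> 0 < y" "k \<ge> 1"
  shows "kth_element Z k \<in> Z" "card {y \<in> Z. y \<le> kth_element Z k} = k"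
proof -
  have "\<exists>!x. x \<in> Z \<and> card {y \<in> Z. y \<le> x} = k"
    using kth_element_exists[OF assms] kth_element_unique[OF assms(1)] by metis
  from theI'[OF this] show "kth_element Z k \<in> Z" "card {y \<in> Z. y \<le> kth_element Z k} = k"
    unfolding kth_element_def by auto
qed

text \<open>
  The count of zeros pins the \<open>k\<close>-th one down. If \<open>r\<close> is the \<open>k\<close>-th zero of \<open>f t0\<close> and the only one in
  \<open>[r - h, r + h]\<close>, then \<open>f t0\<close> has \<open>k - 1\<close> zeros up to \<open>r - h\<close> and \<open>k\<close> up to \<open>r + h\<close>. Both counts
  are the same for \<open>t\<close> near \<open>t0\<close>, which puts the \<open>k\<close>-th zero of \<open>f t\<close> between \<open>r - h\<close> and \<open>r + h\<close>.
\<close>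

lemma isCont_kth_zero:
  fixes f f' :: "'a::t2_space \<Rightarrow> real \<Rightarrow> real"
  assumes cont: "continuous_on UNIV (\<lambda>(t, x). f t x)"
    and cont': "continuous_on UNIV (\<lambda>(t, x). f' t x)"
    and deriv: "\<And>t x. (f t has_real_derivative f' t x) (at x)"
    and simple: "\<And>t x. x > 0 \<Longrightarrow> f t x = 0 \<Longrightarrow> f' t x \<noteq> 0"
    and zero: "\<And>t. f t 0 \<noteq> 0"
    and unbounded: "\<And>t X. \<exists>x>X. f t x = 0"
    and k: "k \<ge> 1"
  defines "Z \<equiv> \<lambda>t. {x. x > 0 \<and> f t x = 0}"
  shows "kth_element (Z t) k \<in> Z t" "isCont (\<lambda>t. kth_element (Z t) k) t0"
proof -
  have Z_eq: "{y \<in> Z t. y \<le> X} = {x \<in> {0..X}. f t x = 0}" for t X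
    using zero[of t] by (force simp: Z_def less_le)
  have simple0: "f' t x \<noteq> 0" if "x \<ge> 0" "f t x = 0" for t x
    using that simple zero by (cases "x = 0") auto
  have fin: "finite {y \<in> Z t. y \<le> X}" for t X
    unfolding Z_eq by (rule finite_simple_zeros[OF deriv]) (use simple0 in auto)
  have unb: "\<exists>y\<in>Z t. X < y" for t X
    using unbounded[of "max 0 X" t] by (auto simp: Z_def)
  note kth = kth_element[of "Z t" k for t, OF fin unb _ k]
  have kth: "kth_element (Z t) k \<in> Z t" "card {y \<in> Z t. y \<le> kth_element (Z t) k} = k" for t
    by (rule kth; simp add: Z_def)+
  then show "kth_element (Z t) k \<in> Z t" by blast
  have const: "eventually (\<lambda>t. card {y \<in> Z t. y \<le> X} = card {y \<in> Z t0. y \<le> X}) (nhds t0)"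
    if "f t0 X \<noteq> 0" for X
    unfolding Z_eq
    by (rule card_zeros_locally_constant[OF cont cont' deriv]) (use simple0 zero that in auto)
  define r where "r = kth_element (Z t0) k"
  have r: "r > 0" "f t0 r = 0" "card {y \<in> Z t0. y \<le> r} = k" "r \<in> Z t0"
    using kth[of t0] by (auto simp: r_def Z_def)
  have "((\<lambda>t. kth_element (Z t) k) \<longlongrightarrow> r) (nhds t0)"
  proof (rule tendstoI)
    fix e :: real assume "e > 0"
    obtain d where d: "d > 0" "\<And>y. y \<in> {y \<in> Z t0. y \<le> r + 1} \<Longrightarrow> y \<noteq> r \<Longrightarrow> d \<le> dist r y"
      using finite_set_avoid[OF fin[of t0 "r + 1"]] by blast
    define h where "h = Min {d / 2, e / 2, r / 2, 1 / 2}"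
    have h: "h > 0" "h < d" "h < e" "h < r" "h < 1"
      using d(1) r(1) \<open>e > 0\<close> unfolding h_def by (auto simp: min_def)
    have only: "y = r" if "f t0 y = 0" "r - h \<le> y" "y \<le> r + h" for y
    proof (rule ccontr)
      assume "y \<noteq> r"
      with that h have "d \<le> dist r y" by (intro d(2)) (auto simp: Z_def)
      with that h show False by (auto simp: dist_real_def abs_if split: if_splits)
    qed
    have "f t0 (r - h) \<noteq> 0" "f t0 (r + h) \<noteq> 0"
      using only[of "r - h"] only[of "r + h"] h by auto
    from const[OF this(1)] const[OF this(2)]
    show "eventually (\<lambda>t. dist (kth_element (Z t) k) r < e) (nhds t0)"
    proof eventually_elim
      case (elim t)
      define s where "s = kth_element (Z t) k"
      have s: "s \<in> Z t" "card {y \<in> Z t. y \<le> s} = k" using kth[of t] by (auto simp: s_def)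
      have "{y \<in> Z t0. y \<le> r + h} = {y \<in> Z t0. y \<le> r}"
        using only h by (force simp: Z_def)
      then have upper: "card {y \<in> Z t. y \<le> r + h} = k" using elim(2) r(3) by simp
      have "{y \<in> Z t0. y \<le> r - h} = {y \<in> Z t0. y \<le> r} - {r}"
        using only h by (force simp: Z_def)
      then have lower: "card {y \<in> Z t. y \<le> r - h} = k - 1"
        using elim(1) r(3,4) fin[of t0 r] by simp
      have "r - h < s"
      proof (rule ccontr)
        assume "\<not> r - h < s"
        then have "card {y \<in> Z t. y \<le> s} \<le> card {y \<in> Z t. y \<le> r - h}"
          using fin by (intro card_mono) auto
        then show False using lower s(2) k by simp
      qed
      moreover have "s \<le> r + h"
      proof (rule ccontr)
        assume "\<not> s \<le> r + h"
        then have "{y \<in> Z t. y \<le> r + h} \<subset> {y \<in> Z t. y \<le> s}" using s(1) by force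
        then have "card {y \<in> Z t. y \<le> r + h} < card {y \<in> Z t. y \<le> s}"
          using fin by (intro psubset_card_mono)
        then show False using upper s(2) by simp
      qed
      ultimately show ?case
        using h unfolding s_def[symmetric] by (auto simp: dist_real_def)
    qed
  qed
  then show "isCont (\<lambda>t. kth_element (Z t) k) t0"
    using tendsto_at_iff_tendsto_nhds[of "\<lambda>t. kth_element (Z t) k" t0] by (simp add: isCont_def r_def)
qed

section \<open>Kummer's function\<close>

text \<open>
  Each factor \<open>(a + j) / (b + j)\<close> has modulus at most \<open>M\<close>. The bound is uniform for \<open>a\<close> in a bounded set,
  so that the series of \<^const>\<open>hyp1F1\<close> is dominated by an exponential series locally uniformly in
  \<open>a\<close> and \<open>z\<close> together; this gives convergence and joint continuity.
\<close>

lemma norm_pochhammer_quotient_le: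
  fixes a :: complex and b M :: real
  assumes "b > 0" "M \<ge> 1" "norm a \<le> M * b"
  shows "norm (pochhammer a k / pochhammer (of_real b) k) \<le> M ^ k"
proof (induction k)
  case (Suc k)
  have nb: "norm (of_real b + of_nat k :: complex) = b + k"
    using assms(1)
    by (metis norm_of_real of_real_add of_real_of_nat_eq abs_of_nonneg add_nonneg_nonneg of_nat_0_le_iff less_imp_le)
  have "norm (a + of_nat k) \<le> norm a + k"
    by (metis norm_of_nat norm_triangle_ineq)
  also have "\<dots> \<le> M * b + M * k"
    using assms mult_right_mono[of 1 M "real k"] by simp
  also have "\<dots> = M * (b + k)" by (simp add: algebra_simps)
  finally have "norm ((a + of_nat k) / (of_real b + of_nat k)) \<le> M"
    unfolding norm_divide nb using assms(1) by (simp add: divide_le_eq)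
  then have "norm (pochhammer a k / pochhammer (of_real b) k) *
      norm ((a + of_nat k) / (of_real b + of_nat k)) \<le> M ^ k * M"
    using Suc assms by (intro mult_mono) auto
  then show ?case
    by (simp add: pochhammer_Suc norm_mult norm_divide mult.commute)
qed simp

lemma norm_hyp1F1_term_le:
  fixes a z :: complex and b M :: real
  assumes "b > 0" "M \<ge> 1" "norm a \<le> M * b" "norm z \<le> R"
  shows "norm (pochhammer a k / pochhammer (of_real b) k * z ^ k / fact k) \<le> (M * R) ^ k / fact k"
proof -
  have "norm (pochhammer a k / pochhammer (of_real b) k) * norm z ^ k \<le> M ^ k * R ^ k"
    using norm_pochhammer_quotient_le[OF assms(1-3), of k] assms by (intro mult_mono power_mono) auto
  then have "norm (pochhammer a k / pochhammer (of_real b) k) * norm z ^ k / fact k \<le> M ^ k * R ^ k / fact k"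
    by (rule divide_right_mono) simp
  then show ?thesis
    by (simp add: norm_mult norm_divide norm_power power_mult_distrib)
qed

lemma summable_power_over_fact: "summable (\<lambda>k. (x::real) ^ k / fact k)"
  using summable_exp_generic[of x] by (simp add: divide_inverse mult.commute)

lemma summable_norm_hyp1F1:
  fixes a z :: complex and b :: real
  assumes "b > 0"
  shows "summable (\<lambda>k. norm (pochhammer a k / pochhammer (of_real b) k * z ^ k / fact k))"
proof -
  define M where "M = max 1 (norm a / b)"
  have M: "M \<ge> 1" "norm a \<le> M * b"
    using assms unfolding M_def by (auto simp: max_def field_simps)
  show ?thesis
    by (rule summable_comparison_test[OF _ summable_power_over_fact[of "M * norm z"]])
       (use norm_hyp1F1_term_le[OF assms M order_refl, where z = z] in auto)
qed

lemma pochhammer_of_real_nonzero: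
  "b > 0 \<Longrightarrow> pochhammer (of_real b :: complex) k \<noteq> 0"
  by (metis pochhammer_pos pochhammer_of_real of_real_eq_0_iff less_irrefl)

lemma continuous_on_hyp1F1:
  fixes b :: real
  assumes "b > 0"
  shows "continuous_on UNIV (\<lambda>(a, z). hyp1F1 a (of_real b) z)"
proof -
  have "isCont (\<lambda>(a, z). hyp1F1 a (of_real b) z) p" for p
  proof -
    obtain a z where p: "p = (a, z)" by force
    define R where "R = norm z + 1"
    define M where "M = max 1 ((norm a + 1) / b)"
    have M: "M \<ge> 1" "norm a + 1 \<le> M * b"
      using assms unfolding M_def by (auto simp: max_def field_simps)
    define A where "A = ball a 1 \<times> ball z 1"
    have A: "open A" "p \<in> A" unfolding A_def p by (auto intro: open_Times)
    have norm_A: "norm (fst q) \<le> M * b" "norm (snd q) \<le> R" if "q \<in> A" for q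
    proof -
      from that have "dist a (fst q) < 1" "dist z (snd q) < 1" by (auto simp: A_def)
      then show "norm (fst q) \<le> M * b" "norm (snd q) \<le> R"
        using M(2) norm_triangle_ineq2[of "fst q" a] norm_triangle_ineq2[of "snd q" z]
        unfolding R_def by (auto simp: dist_norm norm_minus_commute)
    qed
    have "uniform_limit A (\<lambda>n q. \<Sum>k<n. pochhammer (fst q) k / pochhammer (of_real b) k * snd q ^ k / fact k)
            (\<lambda>q. hyp1F1 (fst q) (of_real b) (snd q)) sequentially"
      unfolding hyp1F1_def
      by (rule Weierstrass_m_test[OF _ summable_power_over_fact[of "M * R"]])
         (use norm_hyp1F1_term_le[OF assms M(1)] norm_A in blast)
    moreover have "continuous_on A (\<lambda>q. \<Sum>k<n. pochhammer (fst q) k / pochhammer (of_real b) k * snd q ^ k / fact k)" for n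
      unfolding pochhammer_prod 
      by (intro continuous_intros) (use pochhammer_of_real_nonzero[OF assms] in \<open>auto simp flip: pochhammer_prod\<close>)
    ultimately have "continuous_on A (\<lambda>q. hyp1F1 (fst q) (of_real b) (snd q))"
      by (intro uniform_limit_theorem[of _ _ sequentially]) auto
    then show ?thesis
      using A by (simp add: continuous_on_eq_continuous_at case_prod_unfold)
  qed
  then show ?thesis by (simp add: continuous_at_imp_continuous_on)
qed

lemma continuous_on_hyp1F1_compose [continuous_intros]:
  fixes b :: real
  assumes "b > 0" "continuous_on A f" "continuous_on A g"
  shows "continuous_on A (\<lambda>p. hyp1F1 (f p) (of_real b) (g p))"
  using continuous_on_compose2[OF continuous_on_hyp1F1[OF assms(1)] continuous_on_Pair[OF assms(2,3)]] by simp

lemma DERIV_hyp1F1: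
  fixes b :: real
  assumes "b > 0"
  shows "((\<lambda>z. hyp1F1 a (of_real b) z) has_field_derivative
           a / of_real b * hyp1F1 (a + 1) (of_real (b + 1)) z) (at z)"
proof -
  define c where "c k = pochhammer a k / pochhammer (of_real b) k / fact k" for k
  have "summable (\<lambda>k. c k * z ^ k)" for z
    using summable_norm_cancel[OF summable_norm_hyp1F1[OF assms, of a z]] by (simp add: c_def)
  then have "((\<lambda>z. \<Sum>k. c k * z ^ k) has_field_derivative (\<Sum>k. diffs c k * z ^ k)) (at z)"
    by (rule termdiffs_strong_converges_everywhere)
  moreover have "diffs c k * z ^ k =
      a / of_real b * (pochhammer (a + 1) k / pochhammer (of_real (b + 1)) k * z ^ k / fact k)" for k
    by (simp add: diffs_def c_def pochhammer_rec del: of_nat_Suc)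
  moreover have "summable (\<lambda>k. pochhammer (a + 1) k / pochhammer (of_real (b + 1)) k * z ^ k / fact k)"
    using summable_norm_cancel[OF summable_norm_hyp1F1[of "b + 1" "a + 1" z]] assms by simp
  ultimately have "((\<lambda>z. \<Sum>k. c k * z ^ k) has_field_derivative
      a / of_real b * hyp1F1 (a + 1) (of_real (b + 1)) z) (at z)"
    unfolding hyp1F1_def by (simp only: suminf_mult)
  then show ?thesis
    by (simp add: hyp1F1_def c_def)
qed

lemma hyp1F1_sums:
  fixes b :: real
  assumes "b > 0"
  shows "(\<lambda>k. pochhammer a k / pochhammer (of_real b) k * z ^ k / fact k) sums hyp1F1 a (of_real b) z"
  unfolding hyp1F1_def
  using summable_norm_cancel[OF summable_norm_hyp1F1[OF assms]] by (rule summable_sums)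

text \<open>
  The operator \<open>z d/dz\<close> multiplies the \<open>k\<close>-th term of the series by \<open>k\<close>; the limit is \<open>z\<close> times the
  derivative found in \<open>DERIV_hyp1F1\<close>.
\<close>

lemma hyp1F1_Euler_sums:
  fixes b :: real
  assumes "b > 0"
  defines "c \<equiv> of_real b"
  shows "(\<lambda>k. of_nat k * (pochhammer a k / pochhammer c k * z ^ k / fact k))
           sums (z * (a / c * hyp1F1 (a + 1) (c + 1) z))"
proof -
  define f where "f k = of_nat k * (pochhammer a k / pochhammer c k * z ^ k / fact k)" for k
  have "(\<lambda>k. z * a / c * (pochhammer (a + 1) k / pochhammer (c + 1) k * z ^ k / fact k))
          sums (z * a / c * hyp1F1 (a + 1) (c + 1) z)"
    using hyp1F1_sums[of "b + 1" "a + 1" z] assms by (intro sums_mult) simp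
  moreover have "z * a / c * (pochhammer (a + 1) k / pochhammer (c + 1) k * z ^ k / fact k) = f (Suc k)" for k
    by (simp add: f_def pochhammer_rec divide_simps del: of_nat_Suc)
  ultimately have "f sums (z * a / c * hyp1F1 (a + 1) (c + 1) z)"
    using sums_Suc_iff[of f] by (simp add: f_def[of 0])
  then show ?thesis by (simp add: f_def[abs_def] mult.assoc)
qed

text \<open>
  Kummer's equation \<open>z M'' + (c - z) M' = a M\<close>, with \<open>M'\<close> and \<open>M''\<close> written as contiguous functions.
  If \<open>q k\<close> and \<open>m k\<close> are the \<open>k\<close>-th terms of \<open>M'\<close> and \<open>M\<close>, then \<open>(c + k) q k = (a + k) m k\<close>. By
  \<open>hyp1F1_Euler_sums\<close> the sum of the left-hand sides is \<open>z M'' + c M'\<close> and that of the right-hand sides is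
  \<open>a M + z M'\<close>.
\<close>

lemma hyp1F1_ODE:
  fixes b :: real
  assumes "b > 0"
  defines "c \<equiv> of_real b"
  shows "z * (a / c * ((a + 1) / (c + 1) * hyp1F1 (a + 2) (c + 2) z))
           + (c - z) * (a / c * hyp1F1 (a + 1) (c + 1) z) = a * hyp1F1 a c z"
proof -
  define m where "m k = pochhammer a k / pochhammer c k * z ^ k / fact k" for k
  define q where "q k = a / c * (pochhammer (a + 1) k / pochhammer (c + 1) k * z ^ k / fact k)" for k
  have nz: "pochhammer c k \<noteq> 0" for k
    using pochhammer_of_real_nonzero[of b] assms by (simp add: c_def)
  have "q sums (a / c * hyp1F1 (a + 1) (c + 1) z)"
    using hyp1F1_sums[of "b + 1" "a + 1" z] assms unfolding q_def by (intro sums_mult) simp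
  moreover have "(\<lambda>k. of_nat k * q k) sums (z * (a / c * ((a + 1) / (c + 1) * hyp1F1 (a + 2) (c + 2) z)))"
    using sums_mult[OF hyp1F1_Euler_sums[of "b + 1" "a + 1" z], of "a / c"] assms
    by (simp add: q_def mult_ac add_ac)
  ultimately have "(\<lambda>k. of_nat k * q k + c * q k) sums
      (z * (a / c * ((a + 1) / (c + 1) * hyp1F1 (a + 2) (c + 2) z)) + c * (a / c * hyp1F1 (a + 1) (c + 1) z))"
    by (intro sums_add sums_mult)
  moreover have "of_nat k * q k + c * q k = a * m k + of_nat k * m k" for k
  proof -
    have "q k = (a + of_nat k) * pochhammer a k / ((c + of_nat k) * pochhammer c k) * z ^ k / fact k"
      by (simp add: q_def mult.assoc flip: pochhammer_rec pochhammer_rec')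
         (simp add: pochhammer_rec mult.assoc)
    moreover have "c + of_nat k \<noteq> 0"
      using nz[of "Suc k"] by (auto simp: pochhammer_Suc)
    ultimately have "(c + of_nat k) * q k = (a + of_nat k) * m k"
      by (simp add: m_def)
    then show ?thesis
      by (simp add: algebra_simps)
  qed
  moreover have "(\<lambda>k. a * m k + of_nat k * m k) sums
      (a * hyp1F1 a c z + z * (a / c * hyp1F1 (a + 1) (c + 1) z))"
    using hyp1F1_sums[of b a z] hyp1F1_Euler_sums[of b a z] assms
    unfolding m_def by (intro sums_add sums_mult) auto
  ultimately have "z * (a / c * ((a + 1) / (c + 1) * hyp1F1 (a + 2) (c + 2) z)) + c * (a / c * hyp1F1 (a + 1) (c + 1) z)
      = a * hyp1F1 a c z + z * (a / c * hyp1F1 (a + 1) (c + 1) z)"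
    by (simp add: sums_unique2)
  moreover have "A + (c - z) * X = D" if "A + c * X = D + z * X" for A X D :: complex
    using that by (simp add: algebra_simps)
  ultimately show ?thesis by blast
qed

text \<open>
  Kummer's transformation. In the Cauchy product of the two series, the coefficient of \<open>(- z)^n\<close> is a
  terminating hypergeometric sum at the argument 1, which the Chu--Vandermonde identity evaluates.
\<close>

lemma hyp1F1_Kummer:
  fixes b :: real
  assumes "b > 0"
  shows "exp (- z) * hyp1F1 a (of_real b) z = hyp1F1 (of_real b - a) (of_real b) (- z)"
proof -
  define c :: complex where "c = of_real b"
  have "(\<lambda>n. \<Sum>k\<le>n. pochhammer a k / pochhammer c k * z ^ k / fact k * ((- z) ^ (n - k) / fact (n - k)))
          sums (hyp1F1 a c z * exp (- z))"
    unfolding hyp1F1_def exp_def c_def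
    using Cauchy_product_sums[OF summable_norm_hyp1F1[OF assms, of a z] summable_norm_exp[of "- z"]]
    by (simp add: scaleR_conv_of_real divide_inverse mult_ac)
  moreover have "(\<Sum>k\<le>n. pochhammer a k / pochhammer c k * z ^ k / fact k * ((- z) ^ (n - k) / fact (n - k)))
      = pochhammer (c - a) n / pochhammer c n * (- z) ^ n / fact n" for n
  proof -
    have "\<forall>i\<in>{0..<n}. c \<noteq> - of_nat i"
      using pochhammer_of_real_nonzero[OF assms, of n] by (auto simp: pochhammer_eq_0_iff c_def)
    then have "pochhammer (c - a) n / pochhammer c n = (\<Sum>k\<le>n. pochhammer a k * pochhammer (- of_nat n) k /
                 (of_nat (fact k) * pochhammer c k))"
      using Vandermonde_pochhammer[of n c a] by (simp add: atMost_atLeast0)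
    moreover have "pochhammer a k * pochhammer (- of_nat n) k / (of_nat (fact k) * pochhammer c k) * ((- z) ^ n / fact n)
        = pochhammer a k / pochhammer c k * z ^ k / fact k * ((- z) ^ (n - k) / fact (n - k))"
      if "k \<le> n" for k
    proof -
      have "of_nat (n choose k) = (-1) ^ k * pochhammer (- of_nat n) k / (fact k :: complex)"
        by (simp add: binomial_gbinomial gbinomial_pochhammer)
      then have "pochhammer (- of_nat n) k = (-1) ^ k * (fact k * of_nat (n choose k) :: complex)"
        by simp
      also have "fact k * of_nat (n choose k) = (fact n / fact (n - k) :: complex)"
        using that by (simp add: binomial_fact)
      finally have "pochhammer (- of_nat n) k = (-1) ^ k * (fact n / fact (n - k) :: complex)" .
      moreover have "(- z) ^ n = (- 1) ^ k * z ^ k * (- z) ^ (n - k)"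
        using that by (metis power_add le_add_diff_inverse power_minus)
      ultimately have "pochhammer a k * pochhammer (- of_nat n) k / (of_nat (fact k) * pochhammer c k) * ((- z) ^ n / fact n)
          = pochhammer a k * ((- 1) ^ k * (fact n / fact (n - k))) / (of_nat (fact k) * pochhammer c k)
              * ((- 1) ^ k * z ^ k * (- z) ^ (n - k) / fact n)"
        by simp
      also have "\<dots> = ((- 1) ^ k * (- 1) ^ k) * (pochhammer a k / pochhammer c k * z ^ k / fact k * ((- z) ^ (n - k) / fact (n - k)))"
        by (simp only: of_nat_fact times_divide_eq_right times_divide_eq_left divide_divide_eq_left mult_ac)
           (simp add: mult_ac)
      also have "(- 1) ^ k * (- 1) ^ k = (1 :: complex)"
        by (simp flip: power_mult_distrib)
      finally show ?thesis by simp
    qed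
    ultimately have "pochhammer (c - a) n / pochhammer c n * ((- z) ^ n / fact n) =
        (\<Sum>k\<le>n. pochhammer a k / pochhammer c k * z ^ k / fact k * ((- z) ^ (n - k) / fact (n - k)))"
      by (simp only: sum_distrib_right) (rule sum.cong, simp_all)
    then show ?thesis by simp
  qed
  ultimately show ?thesis
    using hyp1F1_sums[OF assms, of "c - a" "- z"] by (simp add: c_def mult.commute sums_unique2)
qed

lemma hyp1F1_cnj:
  fixes b :: real
  assumes "b > 0"
  shows "hyp1F1 (cnj a) (of_real b) (cnj z) = cnj (hyp1F1 a (of_real b) z)"
proof -
  have "(\<lambda>k. cnj (pochhammer a k / pochhammer (of_real b) k * z ^ k / fact k)) sums cnj (hyp1F1 a (of_real b) z)"
    using hyp1F1_sums[OF assms] by (simp only: sums_cnj)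
  then show ?thesis
    using hyp1F1_sums[OF assms, of "cnj a" "cnj z"] by (simp add: sums_unique2)
qed

lemma hyp1F1_0: "hyp1F1 a b 0 = 1"
  using powser_zero[of "\<lambda>k. pochhammer a k / pochhammer b k / fact k"]
  by (simp add: hyp1F1_def)

section \<open>The real factor of the Coulomb wave function\<close>

lemma has_real_derivative_Re:
  assumes "(h has_field_derivative D) (at (of_real x))"
  shows "((\<lambda>x. Re (h (of_real x))) has_real_derivative Re D) (at x)"
  using bounded_linear.has_vector_derivative[OF bounded_linear_Re has_vector_derivative_real_field[OF assms]]
  by (simp add: has_real_derivative_iff_has_vector_derivative)

text \<open>
  The classical entire function \<open>\<Phi>\<close> in \<open>F(x) = C x\<^sup>l\<^sup>+\<^sup>1 \<Phi>(x)\<close>. It takes a complex argument because the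
  series is differentiated over the complex numbers.
\<close>

definition coulomb_phi :: "real \<Rightarrow> real \<Rightarrow> complex \<Rightarrow> complex" where
  "coulomb_phi l \<eta> w = exp (- \<i> * w) *
     hyp1F1 (of_real l + 1 - \<i> * of_real \<eta>) (of_real (2 * l + 2)) (2 * \<i> * w)"

definition coulomb_phi' :: "real \<Rightarrow> real \<Rightarrow> complex \<Rightarrow> complex" where
  "coulomb_phi' l \<eta> w =
     (let a = of_real l + 1 - \<i> * of_real \<eta>; c = of_real (2 * l + 2) in
      exp (- \<i> * w) * (- \<i> * hyp1F1 a c (2 * \<i> * w)
        + 2 * \<i> * (a / c * hyp1F1 (a + 1) (c + 1) (2 * \<i> * w))))"

text \<open>
  By \<open>coulomb_phi_real\<close> below nothing is lost in taking the real part.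
\<close>

definition coulomb_g :: "real \<Rightarrow> real \<Rightarrow> real \<Rightarrow> real" where
  "coulomb_g l \<eta> x = Re (coulomb_phi l \<eta> (of_real x))"

definition coulomb_g' :: "real \<Rightarrow> real \<Rightarrow> real \<Rightarrow> real" where
  "coulomb_g' l \<eta> x = Re (coulomb_phi' l \<eta> (of_real x))"

text \<open>
  For \<open>a = l + 1 - \<i>\<eta>\<close> and \<open>b = 2l + 2\<close> one has \<open>b - a = cnj a\<close>, and \<open>z = 2\<i>x\<close> satisfies
  \<open>- z = cnj z\<close>. Thus Kummer's transformation relates \<open>M(a, b, z)\<close> to its own complex conjugate.
\<close>

lemma coulomb_phi_real:
  assumes "l > -1"
  shows "coulomb_phi l \<eta> (of_real x) \<in> \<real>"
proof -
  define a where "a = of_real l + 1 - \<i> * of_real \<eta>"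
  define b where "b = 2 * l + 2"
  define z where "z = 2 * \<i> * of_real x"
  have b: "b > 0" using assms by (simp add: b_def)
  have ab: "of_real b - a = cnj a" and z: "- z = cnj z"
    by (simp_all add: a_def b_def z_def)
  have phi: "coulomb_phi l \<eta> (of_real x) = exp (- \<i> * of_real x) * hyp1F1 a (of_real b) z"
    unfolding coulomb_phi_def a_def b_def z_def ..
  have "cnj (coulomb_phi l \<eta> (of_real x)) = exp (\<i> * of_real x) * hyp1F1 (cnj a) (of_real b) (cnj z)"
    unfolding phi hyp1F1_cnj[OF b] complex_cnj_mult by (simp only: exp_cnj complex_cnj_mult complex_cnj_minus complex_cnj_i complex_cnj_complex_of_real minus_minus)
  also have "hyp1F1 (cnj a) (of_real b) (cnj z) = exp (- z) * hyp1F1 a (of_real b) z"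
    using hyp1F1_Kummer[OF b, of z a, unfolded ab z] unfolding z by (rule sym)
  also have "exp (\<i> * of_real x) * (exp (- z) * hyp1F1 a (of_real b) z) =
      (exp (\<i> * of_real x) * exp (- z)) * hyp1F1 a (of_real b) z"
    by (rule mult.assoc[symmetric])
  also have "exp (\<i> * of_real x) * exp (- z) = exp (- \<i> * of_real x)"
    by (simp add: z_def flip: exp_add)
  also have "\<dots> * hyp1F1 a (of_real b) z = coulomb_phi l \<eta> (of_real x)"
    by (rule phi[symmetric])
  finally show ?thesis by (simp add: Reals_cnj_iff)
qed

text \<open>
  The factor in front of \<open>g\<close> is nonzero because the Gamma function has no zeros and its argument
  \<open>l + 1 + \<i>\<eta>\<close>, having positive real part, is not a pole.
\<close>

lemma coulomb_F_eq_0_iff: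
  assumes "l > -1" "x > 0"
  shows "coulomb_F l \<eta> x = 0 \<longleftrightarrow> coulomb_g l \<eta> x = 0"
proof -
  have "Gamma (of_real l + 1 + \<i> * of_real \<eta>) \<noteq> 0"
  proof (rule Gamma_nonzero)
    show "of_real l + 1 + \<i> * of_real \<eta> \<notin> \<int>\<^sub>\<le>\<^sub>0"
    proof
      assume "of_real l + 1 + \<i> * of_real \<eta> \<in> \<int>\<^sub>\<le>\<^sub>0"
      then obtain n where "of_real l + 1 + \<i> * of_real \<eta> = - of_nat n"
        by (auto elim: nonpos_Ints_cases')
      then have "l + 1 = - real n"
        by (auto dest: arg_cong[of _ _ Re])
      then show False using assms by simp
    qed
  qed
  moreover have "Gamma (2 * l + 2) > 0"
    using assms by (intro Gamma_real_pos) simp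
  ultimately have "coulomb_C l \<eta> \<noteq> 0"
    by (simp add: coulomb_C_def)
  moreover have "coulomb_F l \<eta> x = of_real (coulomb_C l \<eta> * x powr (l + 1)) * coulomb_phi l \<eta> (of_real x)"
    by (simp add: coulomb_F_def coulomb_phi_def)
  moreover have "coulomb_phi l \<eta> (of_real x) = of_real (coulomb_g l \<eta> x)"
    using coulomb_phi_real[OF assms(1)] by (simp add: coulomb_g_def)
  ultimately show ?thesis
    using assms(2) by simp
qed

lemma coulomb_zeros_eq:
  "l > -1 \<Longrightarrow> coulomb_zeros l \<eta> = {x. x > 0 \<and> coulomb_g l \<eta> x = 0}"
  unfolding coulomb_zeros_def using coulomb_F_eq_0_iff by auto

lemma coulomb_g_0: "coulomb_g l \<eta> 0 = 1"
  by (simp add: coulomb_g_def coulomb_phi_def hyp1F1_0)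

lemma continuous_on_coulomb_g:
  assumes "l > -1"
  shows "continuous_on UNIV (\<lambda>(\<eta>, x). coulomb_g l \<eta> x)"
  unfolding coulomb_g_def coulomb_phi_def case_prod_unfold
  by (intro continuous_intros) (use assms in auto)

lemma continuous_on_coulomb_g':
  assumes "l > -1"
  shows "continuous_on UNIV (\<lambda>(\<eta>, x). coulomb_g' l \<eta> x)"
proof -
  define b where "b = 2 * l + 2"
  have b: "b > 0" "b + 1 > 0" using assms by (simp_all add: b_def)
  have c: "of_real b + 1 = (of_real (b + 1) :: complex)" by simp
  show ?thesis
    unfolding coulomb_g'_def coulomb_phi'_def case_prod_unfold Let_def b_def[symmetric] c
    by (intro continuous_intros b) (use b in simp_all)
qed

lemma DERIV_hyp1F1_compose:
  fixes b :: real
  assumes "b > 0"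
  shows "((\<lambda>w. hyp1F1 a (of_real b) (2 * \<i> * w)) has_field_derivative
           2 * \<i> * (a / of_real b * hyp1F1 (a + 1) (of_real b + 1) (2 * \<i> * w))) (at w)"
proof -
  have "((\<lambda>w. 2 * \<i> * w) has_field_derivative 2 * \<i>) (at w)"
    by (auto intro!: derivative_eq_intros)
  then show ?thesis
    by (rule DERIV_cong[OF DERIV_chain2[OF DERIV_hyp1F1[OF assms]]]) simp
qed

lemma DERIV_coulomb_g:
  assumes "l > -1"
  shows "(coulomb_g l \<eta> has_real_derivative coulomb_g' l \<eta> x) (at x)"
proof -
  have b: "2 * l + 2 > 0" using assms by simp
  have "(coulomb_phi l \<eta> has_field_derivative coulomb_phi' l \<eta> w) (at w)" for w
    unfolding coulomb_phi_def coulomb_phi'_def Let_def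
    by (rule derivative_eq_intros DERIV_hyp1F1_compose[OF b] refl)+ (simp add: algebra_simps)
  then show ?thesis
    unfolding coulomb_g_def coulomb_g'_def by (rule has_real_derivative_Re)
qed

text \<open>
  This is \<open>x g'' + (2l + 2) g' + (x - 2\<eta>) g = 0\<close> solved for \<open>g''\<close>. Put \<open>z = 2\<i>w\<close>. The exponential turns
  the terms \<open>m0, m1, m2\<close> that stand for \<open>M, M', M''\<close> into \<open>- m0 + 4 m1 - 4 m2\<close> for the second derivative, and
  Kummer's equation for \<open>M\<close> eliminates \<open>m2\<close>.
\<close>

lemma DERIV_coulomb_g':
  assumes "l > -1" "x \<noteq> 0"
  shows "(coulomb_g' l \<eta> has_real_derivative
     - (2 * l + 2) / x * coulomb_g' l \<eta> x - (1 - 2 * \<eta> / x) * coulomb_g l \<eta> x) (at x)"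
proof -
  define b where "b = 2 * l + 2"
  define a where "a = of_real l + 1 - \<i> * of_real \<eta>"
  define w :: complex where "w = of_real x"
  define m0 m1 m2 where "m0 = hyp1F1 a (of_real b) (2 * \<i> * w)"
    and "m1 = a / of_real b * hyp1F1 (a + 1) (of_real b + 1) (2 * \<i> * w)"
    and "m2 = a / of_real b * ((a + 1) / (of_real b + 1) * hyp1F1 (a + 2) (of_real b + 2) (2 * \<i> * w))"
  have b: "b > 0" "b + 1 > 0" using assms by (simp_all add: b_def)
  have d1: "((\<lambda>w. a / of_real b * hyp1F1 (a + 1) (of_real b + 1) (2 * \<i> * w)) has_field_derivative
      2 * \<i> * m2) (at w)"
  proof -
    have e: "of_real (b + 1) = of_real b + (1 :: complex)" "of_real b + 1 + 1 = of_real b + (2 :: complex)"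
      "a + 1 + 1 = a + 2" by simp_all
    have "a / of_real b * (2 * \<i> * X) = 2 * \<i> * (a / of_real b * X)" for X
      by simp
    then show ?thesis
      using DERIV_cmult[OF DERIV_hyp1F1_compose[OF b(2), of "a + 1" w], of "a / of_real b"]
      unfolding m2_def e by metis
  qed
  define f0 f1 where "f0 = (\<lambda>w. hyp1F1 a (of_real b) (2 * \<i> * w))"
    and "f1 = (\<lambda>w. a / of_real b * hyp1F1 (a + 1) (of_real b + 1) (2 * \<i> * w))"
  have "(f0 has_field_derivative 2 * \<i> * f1 w) (at w)"
    unfolding f0_def f1_def by (rule DERIV_hyp1F1_compose[OF b(1)])
  moreover have "(f1 has_field_derivative 2 * \<i> * m2) (at w)"
    unfolding f1_def by (rule d1)
  ultimately have "((\<lambda>w. exp (- \<i> * w) * (- \<i> * f0 w + 2 * \<i> * f1 w)) has_field_derivative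
      exp (- \<i> * w) * (- f0 w + 4 * f1 w - 4 * m2)) (at w)"
    by (auto intro!: derivative_eq_intros simp: algebra_simps)
  then have "(coulomb_phi' l \<eta> has_field_derivative exp (- \<i> * w) * (- m0 + 4 * m1 - 4 * m2)) (at w)"
    unfolding coulomb_phi'_def[abs_def] Let_def b_def[symmetric] a_def[symmetric] f0_def f1_def m0_def m1_def .
  moreover have "exp (- \<i> * w) * (- m0 + 4 * m1 - 4 * m2) =
      of_real (- b / x) * coulomb_phi' l \<eta> w - of_real (1 - 2 * \<eta> / x) * coulomb_phi l \<eta> w"
  proof -
    have K: "2 * \<i> * w * m2 + (of_real b - 2 * \<i> * w) * m1 = a * m0"
      unfolding m0_def m1_def m2_def by (rule hyp1F1_ODE[OF b(1)])
    have a2: "2 * a = of_real b - 2 * \<i> * of_real \<eta>"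
      by (simp add: a_def b_def)
    have phi: "coulomb_phi l \<eta> w = exp (- \<i> * w) * m0"
      "coulomb_phi' l \<eta> w = exp (- \<i> * w) * (- \<i> * m0 + 2 * \<i> * m1)"
      by (simp_all add: coulomb_phi_def coulomb_phi'_def Let_def a_def b_def m0_def m1_def)
    have w: "w \<noteq> 0" using assms by (simp add: w_def)
    have "w * (- m0 + 4 * m1 - 4 * m2) + of_real b * (- \<i> * m0 + 2 * \<i> * m1) + (w - 2 * of_real \<eta>) * m0
        = 2 * \<i> * (2 * \<i> * w * m2 + (of_real b - 2 * \<i> * w) * m1) - \<i> * (of_real b - 2 * \<i> * of_real \<eta>) * m0"
      by (simp add: algebra_simps)
    also have "\<dots> = 0"
      unfolding K a2[symmetric] by simp
    finally have "w * (- m0 + 4 * m1 - 4 * m2) = - of_real b * (- \<i> * m0 + 2 * \<i> * m1) - (w - 2 * of_real \<eta>) * m0"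
      by (simp add: algebra_simps)
    moreover have "X = - c / w * U - (1 - 2 * e / w) * V" if "w * X = - c * U - (w - 2 * e) * V" for X c U V e
    proof -
      have "X = (- c * U - (w - 2 * e) * V) / w"
        using w that by (metis nonzero_mult_div_cancel_left)
      then show ?thesis using w by (simp add: field_simps)
    qed
    ultimately have "- m0 + 4 * m1 - 4 * m2 = - of_real b / w * (- \<i> * m0 + 2 * \<i> * m1) - (1 - 2 * of_real \<eta> / w) * m0"
      by blast
    then have "exp (- \<i> * w) * (- m0 + 4 * m1 - 4 * m2) = exp (- \<i> * w) *
       (- of_real b / w * (- \<i> * m0 + 2 * \<i> * m1) - (1 - 2 * of_real \<eta> / w) * m0)" by simp
    also have "\<dots> = - of_real b / w * coulomb_phi' l \<eta> w - (1 - 2 * of_real \<eta> / w) * coulomb_phi l \<eta> w"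
      unfolding phi by (simp only: right_diff_distrib mult_ac)
    finally show ?thesis by (simp add: w_def)
  qed
  ultimately have "(coulomb_phi' l \<eta> has_field_derivative
      of_real (- b / x) * coulomb_phi' l \<eta> w - of_real (1 - 2 * \<eta> / x) * coulomb_phi l \<eta> w) (at w)"
    by simp
  from has_real_derivative_Re[OF this[unfolded w_def]] show ?thesis
    unfolding coulomb_g_def coulomb_g'_def b_def by (simp flip: of_real_divide of_real_minus of_real_diff)
qed

section \<open>The Wronskian for two parameters\<close>

lemma isCont_coulomb_g: "l > -1 \<Longrightarrow> isCont (coulomb_g l \<eta>) x"
  using DERIV_coulomb_g by (rule DERIV_isCont)

lemma continuous_on_coulomb_g_x: "l > -1 \<Longrightarrow> continuous_on A (coulomb_g l \<eta>)"
  using isCont_coulomb_g by (simp add: continuous_at_imp_continuous_on)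

lemma continuous_on_coulomb_g'_x: "l > -1 \<Longrightarrow> continuous_on A (coulomb_g' l \<eta>)"
  using continuous_on_compose2[OF continuous_on_coulomb_g' continuous_on_Pair[OF continuous_on_const[of A \<eta>] continuous_on_id]]
  by simp

text \<open>
  Abel's identity with two different parameters: in the derivative of the Wronskian the first-order terms of
  the two equations cancel against the derivative of the weight \<open>x\<^sup>2\<^sup>l\<^sup>+\<^sup>2\<close>, and of the zeroth-order
  terms only the difference of \<open>- 2s\<close> and \<open>- 2t\<close> remains. The boundary term at \<open>0\<close> vanishes with the weight. Since
  \<open>2l + 1 > 0\<close>, the integrand is continuous on the closed interval.
\<close>

lemma coulomb_Wronskian:
  assumes l: "l > - 1 / 2" and "r \<ge> 0"
  shows "((\<lambda>x. 2 * (t - s) * (x powr (2 * l + 1) * coulomb_g l s x * coulomb_g l t x)) has_integral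
           r powr (2 * l + 2) * (coulomb_g l s r * coulomb_g' l t r - coulomb_g' l s r * coulomb_g l t r)) {0..r}"
proof -
  define W where "W x = x powr (2 * l + 2) *
      (coulomb_g l s x * coulomb_g' l t x - coulomb_g' l s x * coulomb_g l t x)" for x
  have l1: "l > -1" using l by simp
  have "((\<lambda>x. 2 * (t - s) * (x powr (2 * l + 1) * coulomb_g l s x * coulomb_g l t x)) has_integral W r - W 0) {0..r}"
  proof (rule fundamental_theorem_of_calculus_interior)
    show "continuous_on {0..r} W"
      unfolding W_def using l
      by (intro continuous_intros continuous_on_powr' continuous_on_coulomb_g_x[OF l1] continuous_on_coulomb_g'_x[OF l1]) auto
    fix x assume "x \<in> {0<..<r}"
    then have x: "x > 0" by simp
    then have powr: "x powr (2 * l + 2) = x * x powr (2 * l + 1)"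
      using powr_add[of x 1 "2 * l + 1"] by (simp add: add_ac)
    have "((\<lambda>x. x powr (2 * l + 2)) has_real_derivative (2 * l + 2) * x powr (2 * l + 1)) (at x)"
      using has_real_derivative_powr[OF x, of "2 * l + 2"] by (simp add: algebra_simps)
    note deriv_powr = this
    define u u' v v' where "u = coulomb_g l s x" and "u' = coulomb_g' l s x"
      and "v = coulomb_g l t x" and "v' = coulomb_g' l t x"
    define u'' v'' where "u'' = - (2 * l + 2) / x * u' - (1 - 2 * s / x) * u"
      and "v'' = - (2 * l + 2) / x * v' - (1 - 2 * t / x) * v"
    have D: "(coulomb_g l s has_real_derivative u') (at x)" "(coulomb_g l t has_real_derivative v') (at x)"
      "(coulomb_g' l s has_real_derivative u'') (at x)" "(coulomb_g' l t has_real_derivative v'') (at x)"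
      unfolding u''_def v''_def u_def u'_def v_def v'_def
      using x by (intro DERIV_coulomb_g[OF l1] DERIV_coulomb_g'[OF l1]; simp)+
    have "(W has_real_derivative (2 * l + 2) * x powr (2 * l + 1) * (u * v' - u' * v)
        + ((u' * v' + v'' * u) - (u'' * v + v' * u')) * x powr (2 * l + 2)) (at x)"
      unfolding W_def u_def u'_def v_def v'_def
      by (rule DERIV_mult[OF deriv_powr DERIV_diff[OF DERIV_mult[OF D(1,4)] DERIV_mult[OF D(3,2)],
            unfolded u_def u'_def v_def v'_def]])
    also have "(2 * l + 2) * x powr (2 * l + 1) * (u * v' - u' * v)
        + ((u' * v' + v'' * u) - (u'' * v + v' * u')) * x powr (2 * l + 2)
        = x powr (2 * l + 1) * ((2 * l + 2) * (u * v' - u' * v) + x * (v'' * u - u'' * v))"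
      unfolding powr by (simp add: algebra_simps)
    also have "(2 * l + 2) * (u * v' - u' * v) + x * (v'' * u - u'' * v) = 2 * (t - s) * u * v"
      unfolding u''_def v''_def using x by (simp add: field_simps)
    also have "x powr (2 * l + 1) * (2 * (t - s) * u * v) =
        2 * (t - s) * (x powr (2 * l + 1) * coulomb_g l s x * coulomb_g l t x)"
      by (simp add: u_def v_def)
    finally show "(W has_vector_derivative 2 * (t - s) * (x powr (2 * l + 1) * coulomb_g l s x * coulomb_g l t x)) (at x)"
      by (simp add: has_real_derivative_iff_has_vector_derivative)
  qed (use assms in auto)
  then show ?thesis using l by (simp add: W_def)
qed

text \<open>
  For \<open>s = t\<close> this is, up to a constant factor, the integral of \<open>F\<^sup>2 / x\<close> over \<open>[0, r]\<close>.
\<close>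

definition coulomb_overlap :: "real \<Rightarrow> real \<Rightarrow> real \<Rightarrow> real \<Rightarrow> real" where
  "coulomb_overlap l r s t = integral {0..r} (\<lambda>x. x powr (2 * l + 1) * coulomb_g l s x * coulomb_g l t x)"

lemma continuous_on_overlap_integrand:
  assumes "l > - 1 / 2"
  shows "continuous_on (UNIV \<times> {0..r}) (\<lambda>(t, x). x powr (2 * l + 1) * coulomb_g l s x * coulomb_g l t x)"
proof -
  have l1: "l > -1" using assms by simp
  have "continuous_on (UNIV \<times> {0..r}) (\<lambda>p. coulomb_g l (fst p) (snd p))"
    using continuous_on_subset[OF continuous_on_coulomb_g[OF l1]] by (simp add: case_prod_unfold)
  moreover have "continuous_on (UNIV \<times> {0..r}) (\<lambda>p. coulomb_g l s (snd p))"
    using continuous_on_compose2[OF continuous_on_coulomb_g_x[OF l1, of UNIV] continuous_on_snd[OF continuous_on_id]] by auto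
  ultimately show ?thesis
    unfolding case_prod_unfold
    by (intro continuous_on_mult continuous_on_powr' continuous_intros) (use assms in auto)
qed

lemma isCont_coulomb_overlap:
  assumes "l > - 1 / 2"
  shows "isCont (coulomb_overlap l r s) t"
proof -
  have "continuous_on UNIV (coulomb_overlap l r s)"
    using integral_continuous_on_param[of UNIV 0 r "\<lambda>t x. x powr (2 * l + 1) * coulomb_g l s x * coulomb_g l t x"]
      continuous_on_overlap_integrand[OF assms, of r s]
    by (simp add: coulomb_overlap_def[abs_def])
  then show ?thesis by (simp add: continuous_on_eq_continuous_at)
qed

text \<open>
  The integrand is nonnegative and, as \<open>g\<close> equals \<open>1\<close> at the origin, positive at small \<open>x > 0\<close>.
\<close>

lemma coulomb_overlap_pos:
  assumes l: "l > - 1 / 2" and r: "r > 0"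
  shows "coulomb_overlap l r s s > 0"
proof -
  define h where "h x = x powr (2 * l + 1) * coulomb_g l s x * coulomb_g l s x" for x
  have l1: "l > -1" using l by simp
  have cont: "continuous_on {0..r} h"
    using continuous_on_compose2[OF continuous_on_overlap_integrand[OF l, of r s]
        continuous_on_Pair[OF continuous_on_const[of "{0..r}" s] continuous_on_id]]
    by (simp add: h_def[abs_def] image_subset_iff)
  have nonneg: "h x \<ge> 0" for x by (simp add: h_def mult.assoc)
  have "coulomb_g l s \<midarrow>0\<rightarrow> 1"
    using isCont_coulomb_g[OF l1, where \<eta> = s and x = 0] by (simp add: isCont_def coulomb_g_0)
  then have "eventually (\<lambda>x. coulomb_g l s x > 0) (at 0)"
    by (rule order_tendstoD) simp
  then obtain d where d: "d > 0" "\<And>x. x \<noteq> 0 \<Longrightarrow> \<bar>x\<bar> < d \<Longrightarrow> coulomb_g l s x > 0"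
    unfolding eventually_at by (auto simp: dist_real_def)
  define x where "x = min (d / 2) r"
  have "x \<in> {0..r}" "h x > 0"
    using d(1) d(2)[of x] r by (auto simp: x_def h_def)
  then have "integral {0..r} h \<noteq> 0"
    using integral_eq_0_iff[OF cont r nonneg] by force
  moreover have "integral {0..r} h \<ge> 0"
    using cont nonneg by (intro integral_nonneg integrable_continuous_interval)
  ultimately show ?thesis by (simp add: coulomb_overlap_def h_def[abs_def])
qed

lemma coulomb_Wronskian_at_zero:
  assumes l: "l > - 1 / 2" and r: "r > 0" "coulomb_g l s r = 0"
  shows "- (r powr (2 * l + 2) * coulomb_g' l s r * coulomb_g l t r) = 2 * (t - s) * coulomb_overlap l r s t"
proof -
  have "integral {0..r} (\<lambda>x. 2 * (t - s) * (x powr (2 * l + 1) * coulomb_g l s x * coulomb_g l t x))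
     = - (r powr (2 * l + 2) * coulomb_g' l s r * coulomb_g l t r)"
    using integral_unique[OF coulomb_Wronskian[OF l, of r t s]] r by simp
  then show ?thesis by (simp add: coulomb_overlap_def)
qed

text \<open>
  If \<open>g\<^sub>s\<close> and its derivative both vanished at \<open>r\<close>, the Wronskian at \<open>r\<close> would vanish for every \<open>t\<close>. So would
  the overlap with \<open>t \<noteq> s\<close>, and by continuity also the positive overlap with \<open>t = s\<close>.
\<close>

lemma coulomb_zeros_simple:
  assumes l: "l > - 1 / 2" and r: "r > 0" "coulomb_g l s r = 0"
  shows "coulomb_g' l s r \<noteq> 0"
proof
  assume "coulomb_g' l s r = 0"
  then have "coulomb_overlap l r s t = 0" if "t \<noteq> s" for t
    using coulomb_Wronskian_at_zero[OF assms, of t] that by simp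
  then have "eventually (\<lambda>t. coulomb_overlap l r s t = 0) (at s)"
    by (auto simp: eventually_at intro: exI[of _ 1])
  then have "coulomb_overlap l r s \<midarrow>s\<rightarrow> 0"
    by (rule tendsto_eventually)
  moreover have "coulomb_overlap l r s \<midarrow>s\<rightarrow> coulomb_overlap l r s s"
    using isCont_coulomb_overlap[OF l] by (simp add: isCont_def)
  ultimately have "coulomb_overlap l r s s = 0"
    using LIM_unique by blast
  then show False using coulomb_overlap_pos[OF l r(1), of s] by simp
qed

section \<open>Oscillation\<close>

text \<open>
  Sturm comparison of \<open>u = x\<^sup>l\<^sup>+\<^sup>1 g\<close>, which solves \<open>u'' + Q u = 0\<close> with \<open>Q \<ge> 1 / 4\<close>, with
  \<open>sin ((x - X) / 2)\<close>, which solves \<open>y'' + y / 4 = 0\<close> and is positive strictly between \<open>X\<close> and \<open>X + 2\<pi>\<close>. If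
  \<open>u\<close> were positive on the interval, their Wronskian could not increase there, although it is negative at the left
  end point and positive at the right one.
\<close>

lemma coulomb_zero_in_interval:
  assumes l: "l > -1" and X: "X > 0"
    and q: "\<And>x. x \<ge> X \<Longrightarrow> 1 - 2 * \<eta> / x - l * (l + 1) / x\<^sup>2 \<ge> 1 / 4"
  shows "\<exists>x\<in>{X..X + 2 * pi}. coulomb_g l \<eta> x = 0"
proof (rule ccontr)
  assume no_zero: "\<not> ?thesis"
  define Q where "Q x = 1 - 2 * \<eta> / x - l * (l + 1) / x\<^sup>2" for x
  define m where "m = l + 1"
  \<comment> \<open>Multiplying by the constant \<open>g(X)\<close> makes the solution positive on the interval, whatever its sign.\<close>
  define h where "h x = coulomb_g l \<eta> X * coulomb_g l \<eta> x" for x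
  define h' where "h' x = coulomb_g l \<eta> X * coulomb_g' l \<eta> x" for x
  have h_pos: "h x > 0" if "x \<in> {X..X + 2 * pi}" for x
    unfolding h_def
    by (rule continuous_nonvanishing_same_sign[OF continuous_on_coulomb_g_x[OF l]]) (use no_zero that in auto)
  \<comment> \<open>\<open>B\<close> is \<open>u\<close>, \<open>A\<close> is its derivative and \<open>W\<close> is the Wronskian.\<close>
  define B where "B x = x powr m * h x" for x
  define A where "A x = x powr m * (h' x + m * h x / x)" for x
  define W where "W x = A x * sin ((x - X) / 2) - B x * cos ((x - X) / 2) / 2" for x
  have dh: "(h has_real_derivative h' x) (at x)" for x
    unfolding h_def h'_def using DERIV_cmult[OF DERIV_coulomb_g[OF l]] by blast
  have dh': "(h' has_real_derivative - 2 * m / x * h' x - (1 - 2 * \<eta> / x) * h x) (at x)" if "x > 0" for x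
    unfolding h_def h'_def using DERIV_cmult[OF DERIV_coulomb_g'[OF l, of x \<eta>], of "coulomb_g l \<eta> X"] that
    by (simp add: m_def algebra_simps)
  have dp: "((\<lambda>x. x powr m) has_real_derivative m * (x powr m / x)) (at x)" if "x > 0" for x
    using has_real_derivative_powr[OF that, of m] that by (simp add: powr_diff)
  have dB: "(B has_real_derivative A x) (at x)" if "x > 0" for x
    unfolding B_def
    by (rule DERIV_cong[OF DERIV_mult[OF dp[OF that] dh]]) (simp add: A_def algebra_simps)
  have dA: "(A has_real_derivative - Q x * B x) (at x)" if x: "x > 0" for x
  proof -
    define p where "p = h' x + m * h x / x"
    define p' where "p' = - 2 * m / x * h' x - (1 - 2 * \<eta> / x) * h x + m * (h' x * x - h x) / x\<^sup>2"
    have "((\<lambda>x. h' x + m * h x / x) has_real_derivative p') (at x)"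
      unfolding p'_def
      using x by (auto intro!: derivative_eq_intros dh dh' simp: power2_eq_square right_diff_distrib)
    from DERIV_mult[OF dp[OF x] this]
    have "(A has_real_derivative x powr m * (m * p / x + p')) (at x)"
      unfolding A_def p_def[symmetric] by (simp add: algebra_simps)
    also have "m * p / x + p' = - Q x * h x"
      unfolding p_def p'_def using x by (simp add: Q_def m_def field_simps power2_eq_square)
    finally show ?thesis by (simp add: B_def mult_ac)
  qed
  have dW: "(W has_real_derivative - ((Q x - 1 / 4) * B x * sin ((x - X) / 2))) (at x)"
    if "x > 0" for x
    unfolding W_def using that
    by (auto intro!: derivative_eq_intros dA dB) (simp add: algebra_simps diff_divide_distrib)
  have "W (X + 2 * pi) \<le> W X"
  proof (rule DERIV_nonpos_imp_nonincreasing[of X "X + 2 * pi" W])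
    fix x assume x: "X \<le> x" "x \<le> X + 2 * pi"
    have "B x \<ge> 0" using h_pos[of x] x X by (simp add: B_def)
    moreover have "sin ((x - X) / 2) \<ge> 0" using x by (intro sin_ge_zero) auto
    moreover have "Q x - 1 / 4 \<ge> 0"
      using q[OF x(1)] by (simp only: Q_def diff_ge_0_iff_ge)
    ultimately have "(Q x - 1 / 4) * B x * sin ((x - X) / 2) \<ge> 0"
      by (intro mult_nonneg_nonneg)
    moreover have "(W has_real_derivative - ((Q x - 1 / 4) * B x * sin ((x - X) / 2))) (at x)"
      using dW x X by simp
    ultimately show "\<exists>y. (W has_real_derivative y) (at x) \<and> y \<le> 0"
      by (metis neg_le_0_iff_le)
  qed simp
  moreover have "W X = - B X / 2" "W (X + 2 * pi) = B (X + 2 * pi) / 2"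
    by (simp_all add: W_def)
  moreover have "B X > 0" "B (X + 2 * pi) > 0"
    using h_pos[of X] h_pos[of "X + 2 * pi"] X add_pos_pos[of X "2 * pi"] by (simp_all add: B_def)
  ultimately show False by simp
qed

lemma coulomb_zeros_unbounded:
  assumes "l > -1"
  shows "\<exists>x>X. coulomb_g l \<eta> x = 0"
proof -
  define c where "c = l * (l + 1)"
  define N where "N = max (\<bar>X\<bar> + 1) (8 * (\<bar>\<eta>\<bar> + \<bar>c\<bar>) + 1)"
  have N: "N \<ge> 1" "N > X" "N > 0" by (auto simp: N_def)
  have "1 - 2 * \<eta> / x - c / x\<^sup>2 \<ge> 1 / 4" if "x \<ge> N" for x
  proof -
    have x: "x \<ge> 1" "x \<ge> 8 * (\<bar>\<eta>\<bar> + \<bar>c\<bar>)" using that N(1) by (linarith, simp add: N_def)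
    have "2 * \<eta> / x \<le> 1 / 4"
      using x by (simp add: divide_le_eq)
    moreover have "c / x\<^sup>2 \<le> 1 / 4"
    proof -
      have "4 * c \<le> x * 1" using x by simp
      also have "\<dots> \<le> x * x" using x by (intro mult_left_mono) auto
      finally show ?thesis using x by (simp add: divide_le_eq power2_eq_square)
    qed
    ultimately show ?thesis by simp
  qed
  then obtain x where "x \<in> {N..N + 2 * pi}" "coulomb_g l \<eta> x = 0"
    using coulomb_zero_in_interval[OF assms N(3), of \<eta>] by (auto simp: c_def)
  then show ?thesis using N(2) by (intro exI[of _ x]) auto
qed

section \<open>The derivative of the zeros\<close>

lemma coulomb_rho_eq: "coulomb_rho l \<eta> k = kth_element (coulomb_zeros l \<eta>) k"
  by (simp add: coulomb_rho_def kth_element_def)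

lemma
  assumes l: "l > - 1 / 2" and k: "k \<ge> 1"
  shows coulomb_rho_zero: "coulomb_rho l \<eta> k > 0" "coulomb_g l \<eta> (coulomb_rho l \<eta> k) = 0"
    and isCont_coulomb_rho: "isCont (\<lambda>\<eta>. coulomb_rho l \<eta> k) \<eta>"
proof -
  have l1: "l > -1" using l by simp
  note kth = isCont_kth_zero[OF continuous_on_coulomb_g[OF l1] continuous_on_coulomb_g'[OF l1] DERIV_coulomb_g[OF l1]
      coulomb_zeros_simple[OF l] _ coulomb_zeros_unbounded[OF l1] k, folded coulomb_zeros_eq[OF l1] coulomb_rho_eq]
  show "isCont (\<lambda>\<eta>. coulomb_rho l \<eta> k) \<eta>"
    by (rule kth(2)) (simp_all add: coulomb_g_0)
  have "coulomb_rho l \<eta> k \<in> coulomb_zeros l \<eta>"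
    by (rule kth(1)) (simp_all add: coulomb_g_0)
  then show "coulomb_rho l \<eta> k > 0" "coulomb_g l \<eta> (coulomb_rho l \<eta> k) = 0"
    by (simp_all add: coulomb_zeros_eq[OF l1])
qed

text \<open>
  The numerator of the difference quotient comes from the Wronskian identity at the zero \<open>r\<close> of \<open>g\<^sub>s\<close>, its
  denominator from the mean value theorem for \<open>g\<^sub>t\<close> between \<open>r\<close> and the zero \<open>\<rho> t\<close> of \<open>g\<^sub>t\<close>.
\<close>

lemma DERIV_coulomb_rho:
  fixes k :: nat and l s :: real
  assumes l: "l > - 1 / 2" and k: "k \<ge> 1"
  defines "r \<equiv> coulomb_rho l s k"
  shows "((\<lambda>\<eta>. coulomb_rho l \<eta> k) has_real_derivative
     2 * coulomb_overlap l r s s / (r powr (2 * l + 2) * (coulomb_g' l s r)\<^sup>2)) (at s)"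
proof -
  have l1: "l > -1" using l by simp
  define \<rho> where "\<rho> t = coulomb_rho l t k" for t
  have r: "r > 0" "coulomb_g l s r = 0" "r = \<rho> s"
    using coulomb_rho_zero[OF l k, of s] by (auto simp: r_def \<rho>_def)
  have \<rho>: "\<rho> \<midarrow>s\<rightarrow> r"
    using isCont_coulomb_rho[OF l k, of s] by (simp add: isCont_def \<rho>_def[abs_def] r_def)
  have "\<exists>x. \<bar>x - r\<bar> \<le> \<bar>\<rho> t - r\<bar> \<and> coulomb_g l t r = coulomb_g' l t x * (r - \<rho> t)" for t
  proof -
    have zero: "coulomb_g l t (\<rho> t) = 0" using coulomb_rho_zero[OF l k, of t] by (simp add: \<rho>_def)
    consider "\<rho> t < r" | "\<rho> t = r" | "r < \<rho> t" by linarith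
    then show ?thesis
    proof cases
      case 1
      obtain x where "\<rho> t < x" "x < r" "coulomb_g l t r - coulomb_g l t (\<rho> t) = (r - \<rho> t) * coulomb_g' l t x"
        using MVT2[OF 1, of "coulomb_g l t" "coulomb_g' l t"] DERIV_coulomb_g[OF l1] by blast
      then show ?thesis using zero by (intro exI[of _ x]) (simp add: mult.commute)
    next
      case 2
      then show ?thesis using zero by auto
    next
      case 3
      obtain x where "r < x" "x < \<rho> t" "coulomb_g l t (\<rho> t) - coulomb_g l t r = (\<rho> t - r) * coulomb_g' l t x"
        using MVT2[OF 3, of "coulomb_g l t" "coulomb_g' l t"] DERIV_coulomb_g[OF l1] by blast
      then show ?thesis using zero by (intro exI[of _ x]) (simp add: algebra_simps)
    qed
  qed
  then obtain \<xi> where \<xi>: "\<And>t. \<bar>\<xi> t - r\<bar> \<le> \<bar>\<rho> t - r\<bar>"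
      "\<And>t. coulomb_g l t r = coulomb_g' l t (\<xi> t) * (r - \<rho> t)"
    by metis
  have "((\<lambda>t. \<rho> t - r) \<longlongrightarrow> 0) (at s)" using \<rho> by (simp add: LIM_zero_iff)
  then have "((\<lambda>t. \<xi> t - r) \<longlongrightarrow> 0) (at s)"
    by (rule Lim_null_comparison[rotated, OF tendsto_rabs_zero]) (simp add: \<xi>)
  then have "\<xi> \<midarrow>s\<rightarrow> r" by (simp add: LIM_zero_iff)
  then have "((\<lambda>t. (t, \<xi> t)) \<longlongrightarrow> (s, r)) (at s)"
    by (intro tendsto_Pair tendsto_ident_at)
  moreover have "isCont (\<lambda>(t, x). coulomb_g' l t x) (s, r)"
    using continuous_on_coulomb_g'[OF l1] by (simp add: continuous_on_eq_continuous_at)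
  ultimately have slope: "((\<lambda>t. coulomb_g' l t (\<xi> t)) \<longlongrightarrow> coulomb_g' l s r) (at s)"
    using isCont_tendsto_compose[of "(s, r)" "\<lambda>(t, x). coulomb_g' l t x" "\<lambda>t. (t, \<xi> t)" "at s"]
    by simp
  have g': "coulomb_g' l s r \<noteq> 0" by (rule coulomb_zeros_simple[OF l r(1,2)])
  define Q where "Q t = 2 * coulomb_overlap l r s t / (r powr (2 * l + 2) * (coulomb_g' l s r * coulomb_g' l t (\<xi> t)))" for t
  have "(Q \<longlongrightarrow> 2 * coulomb_overlap l r s s / (r powr (2 * l + 2) * (coulomb_g' l s r * coulomb_g' l s r))) (at s)"
    unfolding Q_def using slope isCont_coulomb_overlap[OF l, where r = r and s = s and t = s] g' r(1)
    by (intro tendsto_intros) (auto simp: isCont_def)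
  moreover have "eventually (\<lambda>t. coulomb_g' l t (\<xi> t) \<noteq> 0) (at s)"
    using slope g' by (rule tendsto_imp_eventually_ne)
  then have "eventually (\<lambda>t. Q t = (\<rho> t - \<rho> s) / (t - s)) (at s)"
    using eventually_neq_at_within[of s s UNIV]
  proof eventually_elim
    case (elim t)
    have "- (r powr (2 * l + 2) * coulomb_g' l s r * (coulomb_g' l t (\<xi> t) * (r - \<rho> t))) = 2 * (t - s) * coulomb_overlap l r s t"
      using coulomb_Wronskian_at_zero[OF l r(1,2), of t] unfolding \<xi>(2) .
    then have eq: "2 * coulomb_overlap l r s t * (t - s) = (\<rho> t - r) * (r powr (2 * l + 2) * (coulomb_g' l s r * coulomb_g' l t (\<xi> t)))"
      by (simp add: algebra_simps)
    have "r powr (2 * l + 2) * (coulomb_g' l s r * coulomb_g' l t (\<xi> t)) \<noteq> 0" "t - s \<noteq> 0"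
      using r(1) g' elim by auto
    from frac_eq_eq[OF this] eq show ?case
      unfolding Q_def r(3)[symmetric] by blast
  qed
  ultimately have "((\<lambda>t. (\<rho> t - \<rho> s) / (t - s)) \<longlongrightarrow>
      2 * coulomb_overlap l r s s / (r powr (2 * l + 2) * (coulomb_g' l s r * coulomb_g' l s r))) (at s)"
    by (rule Lim_transform_eventually)
  then show ?thesis
    by (simp add: has_field_derivative_iff \<rho>_def power2_eq_square)
qed

theorem theorem4p2:
  fixes k :: nat and l :: real
  assumes "k \<ge> 1" and "l > - 1 / 2"
  shows "strict_mono (\<lambda>\<eta>. coulomb_rho l \<eta> k) \<and>
         (\<forall>\<eta>. (\<lambda>\<eta>. coulomb_rho l \<eta> k) differentiable (at \<eta>) \<and>
              deriv (\<lambda>\<eta>. coulomb_rho l \<eta> k) \<eta> > 0)"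
proof -
  have deriv: "\<exists>D>0. ((\<lambda>\<eta>. coulomb_rho l \<eta> k) has_real_derivative D) (at \<eta>)" for \<eta>
  proof (intro exI conjI)
    define r where "r = coulomb_rho l \<eta> k"
    have r: "r > 0" "coulomb_g l \<eta> r = 0"
      using coulomb_rho_zero[OF assms(2,1), of \<eta>] by (auto simp: r_def)
    show "0 < 2 * coulomb_overlap l r \<eta> \<eta> / (r powr (2 * l + 2) * (coulomb_g' l \<eta> r)\<^sup>2)"
      using coulomb_overlap_pos[OF assms(2) r(1), of \<eta>] coulomb_zeros_simple[OF assms(2) r] r(1) by simp
    show "((\<lambda>\<eta>. coulomb_rho l \<eta> k) has_real_derivative
        2 * coulomb_overlap l r \<eta> \<eta> / (r powr (2 * l + 2) * (coulomb_g' l \<eta> r)\<^sup>2)) (at \<eta>)"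
      unfolding r_def by (rule DERIV_coulomb_rho[OF assms(2,1)])
  qed
  have "strict_mono (\<lambda>\<eta>. coulomb_rho l \<eta> k)"
  proof (rule strict_monoI)
    fix a b :: real assume "a < b"
    then show "coulomb_rho l a k < coulomb_rho l b k"
    proof (rule DERIV_pos_imp_increasing[of a b "\<lambda>\<eta>. coulomb_rho l \<eta> k"])
      show "\<exists>D. ((\<lambda>\<eta>. coulomb_rho l \<eta> k) has_real_derivative D) (at x) \<and> D > 0" for x
        using deriv[of x] by blast
    qed
  qed
  moreover have "(\<lambda>\<eta>. coulomb_rho l \<eta> k) differentiable (at \<eta>) \<and> deriv (\<lambda>\<eta>. coulomb_rho l \<eta> k) \<eta> > 0" for \<eta>
    using deriv[of \<eta>] by (metis DERIV_imp_deriv real_differentiable_def)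
  ultimately show ?thesis by blast
qed

end
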